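(* Let $G$ be an infinite group and $S$ a finite symmetric generating set of $G$. If $(G,S)$ has dead ends of arbitrarily large depth (i.e. for every $D>0$ there is an element of $G$ that is a dead end of depth at least $D$), then the complete growth series of $(G,S)$ is not $\mathbb{N}G$-rational.
   Context: For a group $G$ with finite symmetric generating set $S$, $\|g\|_S$ denotes the word length of $g\in G$. An element $g\in G$ is a dead end of depth at least $D$ (with $D>0$) if $\|gh\|_S\le\|g\|_S$ for every $h\in G$ with $\|h\|_S\le D$. $\mathbb{N}G$ is the group semiring (finite formal sums of elements of $G$ with coefficients in $\mathbb{N}=\{0,1,2,\dots\}$), and $\mathbb{N}G[[s]]$ is the semiring of formal power series over it, the variable $s$ commuting with coefficients. The complete growth series of $(G,S)$ is $\sum_{n\ge 0}\big(\sum_{\|g\|_S=n} g\big)s^n\in\mathbb{N}G[[s]]$. A series in $\mathbb{N}G[[s]]$ is proper if its constant coefficient is $0$. A proper linear system over $\mathbb{N}G[s]$ is a finite system of equations $X_i=P_i(X_1,\dots,X_n)$, $i=1,\dots,n$, where each $P_i$ is a finite sum of monomials of the form $r\cdot s^k$ or $rX_j\cdot s^k$ with $r\in\mathbb{N}G$, $1\le j\le n$ and $k\ge 1$; such a system has a unique solution $(F_1,\dots,F_n)$ consisting of proper series. A series $F=\sum_{n\ge0}a_ns^n\in\mathbb{N}G[[s]]$ is $\mathbb{N}G$-rational if $\sum_{n\ge1}a_ns^n$ is the first component of the proper solution of some proper linear system over $\mathbb{N}G[s]$. *)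

theory Defs
  imports "HOL-Library.Poly_Mapping" "HOL-Computational_Algebra.Formal_Power_Series"
begin

unbundle fps_syntax

text \<open>
  Groups are types of class \<open>group_add\<close>. This class does not assume commutativity: the group
  product \<open>g h\<close> is written \<open>g + h\<close>, the identity \<open>0\<close> and the inverse \<open>- g\<close>, and
  \<open>sum_list\<close> is the ordered product of a word.
\<close>

definition symmetric_set :: "'a::group_add set \<Rightarrow> bool" where
  "symmetric_set S \<longleftrightarrow> (\<forall>s\<in>S. - s \<in> S)"

definition generates :: "'a::group_add set \<Rightarrow> bool" where
  "generates S \<longleftrightarrow> (\<forall>g. \<exists>w. set w \<subseteq> S \<union> uminus ` S \<and> sum_list w = g)"

text \<open>
  Words use letters of \<open>S\<close> only, so this is the usual length for symmetric \<open>S\<close>; it is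
  meaningful only when \<open>S\<close> is symmetric and generating.
\<close>

definition word_length :: "'a::group_add set \<Rightarrow> 'a \<Rightarrow> nat" where
  "word_length S g = (LEAST n. \<exists>w. length w = n \<and> set w \<subseteq> S \<and> sum_list w = g)"

definition dead_end :: "'a::group_add set \<Rightarrow> nat \<Rightarrow> 'a \<Rightarrow> bool" where
  "dead_end S D g \<longleftrightarrow>
     D > 0 \<and> (\<forall>h. word_length S h \<le> D \<longrightarrow> word_length S (g + h) \<le> word_length S g)"

text \<open>
  The multiplication on \<open>'a \<Rightarrow>\<^sub>0 nat\<close> is convolution with respect to the group operation \<open>+\<close>,
  so that this type is the group semiring; \<open>single g 1\<close> is the group element \<open>g\<close> in it.
\<close>

type_synonym 'a group_semiring = "'a \<Rightarrow>\<^sub>0 nat"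

definition complete_growth_series :: "'a::group_add set \<Rightarrow> 'a group_semiring fps" where
  "complete_growth_series S =
     Abs_fps (\<lambda>n. \<Sum>g | word_length S g = n. Poly_Mapping.single g 1)"

definition proper_series :: "'a::group_add group_semiring fps \<Rightarrow> bool" where
  "proper_series F \<longleftrightarrow> F $ 0 = 0"

text \<open>
  \<open>Const r k\<close> is the monomial \<open>r s\<^sup>k\<close> and \<open>Linear r j k\<close> is the monomial \<open>r X\<^sub>j s\<^sup>k\<close>.
  The right-hand side \<open>P i\<close> of an equation is the sum of a list of monomials, and the unknowns
  are indexed by \<open>1, \<dots>, n\<close>.
\<close>

datatype 'a monomial =
    Const "'a group_semiring" nat
  | Linear "'a group_semiring" nat nat

fun proper_monomial :: "nat \<Rightarrow> 'a monomial \<Rightarrow> bool" where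
  "proper_monomial n (Const r k) \<longleftrightarrow> k \<ge> 1"
| "proper_monomial n (Linear r j k) \<longleftrightarrow> j \<in> {1..n} \<and> k \<ge> 1"

fun eval_monomial ::
  "(nat \<Rightarrow> 'a::group_add group_semiring fps) \<Rightarrow> 'a monomial \<Rightarrow> 'a group_semiring fps" where
  "eval_monomial F (Const r k) = fps_const r * fps_X ^ k"
| "eval_monomial F (Linear r j k) = fps_const r * F j * fps_X ^ k"

definition eval_rhs ::
  "(nat \<Rightarrow> 'a::group_add group_semiring fps) \<Rightarrow> 'a monomial list \<Rightarrow> 'a group_semiring fps" where
  "eval_rhs F ms = (\<Sum>m\<leftarrow>ms. eval_monomial F m)"

definition proper_linear_system :: "nat \<Rightarrow> (nat \<Rightarrow> 'a monomial list) \<Rightarrow> bool" where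
  "proper_linear_system n P \<longleftrightarrow> (\<forall>i\<in>{1..n}. \<forall>m\<in>set (P i). proper_monomial n m)"

definition proper_solution ::
  "nat \<Rightarrow> (nat \<Rightarrow> 'a monomial list) \<Rightarrow> (nat \<Rightarrow> 'a::group_add group_semiring fps) \<Rightarrow> bool" where
  "proper_solution n P F \<longleftrightarrow> (\<forall>i\<in>{1..n}. proper_series (F i) \<and> F i = eval_rhs F (P i))"

definition rational_series :: "'a::group_add group_semiring fps \<Rightarrow> bool" where
  "rational_series F \<longleftrightarrow>
     (\<exists>n P X. n \<ge> 1 \<and> proper_linear_system n P \<and> proper_solution n P X \<and>
        X 1 = Abs_fps (\<lambda>k. if k = 0 then 0 else F $ k))"

text \<open>
  A proper linear system has exactly one proper solution, which justifies the existential
  quantifier over solutions in the definition above.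
\<close>

lemma eval_monomial_nth_cong:
  assumes "proper_monomial n m"
    and "\<And>j l. j \<in> {1..n} \<Longrightarrow> l < k \<Longrightarrow> F j $ l = H j $ l"
  shows "eval_monomial F m $ k = eval_monomial H m $ k"
proof (cases m)
  case (Linear r j d)
  have "F j $ (k - d) = H j $ (k - d)" if "d \<le> k"
    using assms Linear that by auto
  then show ?thesis
    by (simp add: Linear fps_X_power_mult_right_nth)
qed simp

lemma eval_rhs_nth_cong:
  assumes "\<forall>m\<in>set ms. proper_monomial n m"
    and "\<And>j l. j \<in> {1..n} \<Longrightarrow> l < k \<Longrightarrow> F j $ l = H j $ l"
  shows "eval_rhs F ms $ k = eval_rhs H ms $ k"
  using assms(1)
proof (induction ms)
  case (Cons m ms)
  have "eval_monomial F m $ k = eval_monomial H m $ k"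
    by (rule eval_monomial_nth_cong) (use Cons.prems assms(2) in auto)
  with Cons show ?case
    by (simp add: eval_rhs_def)
qed (simp add: eval_rhs_def)

lemma proper_solution_unique:
  assumes P: "proper_linear_system n P"
    and F: "proper_solution n P F" and H: "proper_solution n P H"
    and i: "i \<in> {1..n}"
  shows "F i = H i"
proof -
  have "\<forall>i\<in>{1..n}. F i $ k = H i $ k" for k
  proof (induction k rule: less_induct)
    case (less k)
    show ?case
    proof
      fix i assume i: "i \<in> {1..n}"
      have "eval_rhs F (P i) $ k = eval_rhs H (P i) $ k"
        by (rule eval_rhs_nth_cong) (use P i less in \<open>auto simp: proper_linear_system_def\<close>)
      then show "F i $ k = H i $ k"
        using F H i by (metis proper_solution_def)
    qed
  qed
  then show ?thesis
    using i by (simp add: fps_eq_iff)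
qed

lemma proper_solution_exists:
  fixes P :: "nat \<Rightarrow> 'a::group_add monomial list"
  assumes P: "proper_linear_system n P"
  shows "\<exists>F. proper_solution n P F"
proof -
  define A :: "nat \<Rightarrow> nat \<Rightarrow> 'a group_semiring fps"
    where "A t = ((\<lambda>F i. eval_rhs F (P i)) ^^ t) (\<lambda>_. 0)" for t
  define F where "F i = Abs_fps (\<lambda>k. A (Suc k) i $ k)" for i
  have A_Suc: "A (Suc t) i = eval_rhs (A t) (P i)" for t i
    by (simp add: A_def)
  have stable: "\<forall>t>k. \<forall>i\<in>{1..n}. A t i $ k = F i $ k" for k
  proof (induction k rule: less_induct)
    case (less k)
    show ?case
    proof (intro allI impI ballI)
      fix t i assume "k < t" and i: "i \<in> {1..n}"
      then obtain u where u: "t = Suc u" "k \<le> u"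
        by (cases t) auto
      have "eval_rhs (A u) (P i) $ k = eval_rhs (A k) (P i) $ k"
        by (rule eval_rhs_nth_cong)
          (use P i u less in \<open>auto simp: proper_linear_system_def\<close>)
      then show "A t i $ k = F i $ k"
        by (simp add: u A_Suc F_def)
    qed
  qed
  have eq: "F i = eval_rhs F (P i)" if i: "i \<in> {1..n}" for i
  proof (rule fps_ext)
    fix k
    have "eval_rhs (A k) (P i) $ k = eval_rhs F (P i) $ k"
      by (rule eval_rhs_nth_cong)
        (use P i stable in \<open>auto simp: proper_linear_system_def\<close>)
    then show "F i $ k = eval_rhs F (P i) $ k"
      by (simp add: F_def A_Suc)
  qed
  have mono: "eval_monomial F m $ 0 = 0" if "proper_monomial n m" for m
    using that by (cases m) (auto simp: fps_X_power_mult_right_nth)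
  have "eval_rhs F ms $ 0 = 0" if "\<forall>m\<in>set ms. proper_monomial n m" for ms
    using that by (induction ms) (auto simp: eval_rhs_def mono)
  then have "F i $ 0 = 0" if "i \<in> {1..n}" for i
    using P eq[OF that] that by (metis proper_linear_system_def)
  with eq have "proper_solution n P F"
    unfolding proper_solution_def proper_series_def by blast
  then show ?thesis
    by blast
qed

end

theory Submission
  imports Defs
begin

text \<open>
  Coefficients in \<open>\<nat>\<close> cannot cancel, so a proper linear system is a finite automaton as far as
  supports are concerned: \<open>g\<close> lies in the support of the \<open>s\<^sup>N\<close>-coefficient of \<open>X\<^sub>i\<close> if and only if
  \<open>g\<close> is the product of labels along a run from state \<open>i\<close> of total degree \<open>N\<close>. Suppose that such a
  system describes the complete growth series. Then a run from state \<open>1\<close> with product \<open>g\<close> has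
  degree exactly the length of \<open>g\<close>.

  Cut the run of a long element \<open>g\<close> so that the remaining part, from some state \<open>j\<close>, has bounded
  degree, but a degree larger than that of every nonzero coefficient of every \<open>X\<^sub>i\<close> that is a
  polynomial in \<open>s\<close>. Then \<open>X\<^sub>j\<close> is not a polynomial, and the remaining part can be replaced by a
  run from \<open>j\<close> of higher degree, chosen once for each state. The new product is \<open>g h\<close> with \<open>h\<close> in
  a finite set \<open>H\<close> independent of \<open>g\<close> (lemma \<open>proper_solution_bounded_extension\<close>), and it is longer
  than \<open>g\<close>. So a long element is never a dead end of depth at least the lengths of all members of
  \<open>H\<close>. On the other hand, in an infinite group dead ends of large depth are long
  (lemma \<open>dead_end_long\<close>), because a short element is at bounded distance from a fixed longer one.
\<close>

section \<open>Supports in the group semiring\<close>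

lemma keys_plus_nat: "Poly_Mapping.keys (p + q :: 'a \<Rightarrow>\<^sub>0 nat) = Poly_Mapping.keys p \<union> Poly_Mapping.keys q"
  by (auto simp: in_keys_iff lookup_add)

lemma nat_poly_mapping_split_single:
  fixes p :: "'a \<Rightarrow>\<^sub>0 nat"
  assumes "a \<in> Poly_Mapping.keys p"
  obtains q where "p = Poly_Mapping.single a 1 + q"
proof
  show "p = Poly_Mapping.single a 1 + (p - Poly_Mapping.single a 1)"
    using assms
    by (intro poly_mapping_eqI) (auto simp: lookup_add lookup_minus lookup_single when_def in_keys_iff)
qed

text \<open>
  The inclusion from left to right holds over every semiring; the other one is the absence of
  cancellation: splitting off \<open>a\<close> from \<open>p\<close> and \<open>b\<close> from \<open>q\<close> exhibits \<open>a + b\<close> as a summand of the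
  product.
\<close>

lemma keys_times_nat:
  fixes p q :: "'a::monoid_add \<Rightarrow>\<^sub>0 nat"
  shows "Poly_Mapping.keys (p * q) = {a + b | a b. a \<in> Poly_Mapping.keys p \<and> b \<in> Poly_Mapping.keys q}"
proof
  show "{a + b | a b. a \<in> Poly_Mapping.keys p \<and> b \<in> Poly_Mapping.keys q} \<subseteq> Poly_Mapping.keys (p * q)"
  proof clarify
    fix a b assume "a \<in> Poly_Mapping.keys p" "b \<in> Poly_Mapping.keys q"
    then obtain p' q' where
      "p = Poly_Mapping.single a 1 + p'" "q = Poly_Mapping.single b 1 + q'"
      by (meson nat_poly_mapping_split_single)
    then have "p * q = Poly_Mapping.single (a + b) 1 + (Poly_Mapping.single a 1 * q' + p' * q)"
      by (simp add: distrib_left distrib_right mult_single add.assoc add.left_commute)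
    then show "a + b \<in> Poly_Mapping.keys (p * q)"
      by (simp add: keys_plus_nat)
  qed
qed (rule keys_mult)

section \<open>Linear systems as automata\<close>

lemma keys_eval_rhs:
  "Poly_Mapping.keys (eval_rhs F ms $ N) = (\<Union>m\<in>set ms. Poly_Mapping.keys (eval_monomial F m $ N))"
  by (induction ms) (auto simp: eval_rhs_def keys_plus_nat)

lemma keys_eval_Const:
  "Poly_Mapping.keys (eval_monomial F (Const r k) $ N) = (if N = k then Poly_Mapping.keys r else {})"
  by (auto simp: fps_X_power_mult_right_nth)

lemma keys_eval_Linear:
  "Poly_Mapping.keys (eval_monomial F (Linear r j k) $ N) =
     (if k \<le> N then {a + b | a b. a \<in> Poly_Mapping.keys r \<and> b \<in> Poly_Mapping.keys (F j $ (N - k))} else {})"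
  by (auto simp: fps_X_power_mult_right_nth keys_times_nat)

fun monomial_degree :: "'a monomial \<Rightarrow> nat" where
  "monomial_degree (Const r k) = k"
| "monomial_degree (Linear r j k) = k"

text \<open>
  This is where rationality enters. The finite set of right factors comes from the finitely many
  short runs and one long run for each state with runs of unbounded degree. The statement concerns
  all states at once so that it can be proved by peeling off the first transition of a run.
\<close>

lemma proper_solution_bounded_extension:
  fixes F :: "nat \<Rightarrow> 'a::group_add group_semiring fps"
  assumes P: "proper_linear_system n P" and F: "proper_solution n P F"
  shows "\<exists>H M. finite H \<and> (\<forall>i\<in>{1..n}. \<forall>N>M. \<forall>g\<in>Poly_Mapping.keys (F i $ N).
           \<exists>h\<in>H. \<exists>N'>N. g + h \<in> Poly_Mapping.keys (F i $ N'))"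
proof -
  \<comment> \<open>\<open>M\<close> bounds the degree of every \<open>F i\<close> that is a polynomial in \<open>s\<close>.\<close>
  have "\<forall>i. \<exists>b. (\<exists>N>b. F i $ N \<noteq> 0) \<longrightarrow> (\<forall>B. \<exists>N>B. F i $ N \<noteq> 0)"
    by blast
  from choice[OF this] obtain b where b: "\<And>i N B. N > b i \<Longrightarrow> F i $ N \<noteq> 0 \<Longrightarrow> \<exists>N>B. F i $ N \<noteq> 0"
    by blast
  define M where "M = (\<Sum>i\<in>{1..n}. b i)"
  have unbounded: "\<exists>N>B. F i $ N \<noteq> 0" if "i \<in> {1..n}" "N > M" "F i $ N \<noteq> 0" for i N B
  proof -
    have "b i \<le> M"
      unfolding M_def using that(1) by (intro member_le_sum) auto
    then show ?thesis
      using b that by (meson le_less_trans)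
  qed
  \<comment> \<open>A transition lowers the degree of the remaining run by at most \<open>K\<close>, so it cannot jump over the
    window of degrees from \<open>M + 1\<close> to \<open>M + K\<close>.\<close>
  define K where "K = (\<Sum>m\<in>(\<Union>i\<in>{1..n}. set (P i)). monomial_degree m)"
  have K: "monomial_degree m \<le> K" if "i \<in> {1..n}" "m \<in> set (P i)" for i m
    unfolding K_def using that by (intro member_le_sum) auto
  have "\<forall>i. \<exists>f. (\<exists>N>M + K. F i $ N \<noteq> 0) \<longrightarrow> (\<exists>N>M + K. f \<in> Poly_Mapping.keys (F i $ N))"
    by (meson equals0I keys_eq_empty)
  from choice[OF this] obtain f where
    f: "\<And>i N. N > M + K \<Longrightarrow> F i $ N \<noteq> 0 \<Longrightarrow> \<exists>N>M + K. f i \<in> Poly_Mapping.keys (F i $ N)"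
    by blast
  define H where "H = (\<Union>i\<in>{1..n}. \<Union>N\<in>{..M + K}. (\<lambda>c. - c + f i) ` Poly_Mapping.keys (F i $ N))"
  have "finite H"
    by (auto simp: H_def)
  moreover have "\<exists>h\<in>H. \<exists>N'>N. g + h \<in> Poly_Mapping.keys (F i $ N')"
    if "i \<in> {1..n}" "g \<in> Poly_Mapping.keys (F i $ N)" "N > M" for i g N
    using that
  proof (induction N arbitrary: i g rule: less_induct)
    case (less N)
    show ?case
    proof (cases "N \<le> M + K")
      case True
      have "F i $ N \<noteq> 0"
        using less.prems by auto
      then obtain N' where "N' > M + K" "f i \<in> Poly_Mapping.keys (F i $ N')"
        using f unbounded[OF less.prems(1,3)] by meson
      moreover have "- g + f i \<in> H"
        unfolding H_def using less.prems True by blast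
      ultimately show ?thesis
        using True by (intro bexI[of _ "- g + f i"] exI[of _ N']) (auto simp: add.assoc[symmetric])
    next
      case False
      have rhs: "F i $ N' = eval_rhs F (P i) $ N'" for N'
        using F less.prems by (metis proper_solution_def)
      obtain m where m: "m \<in> set (P i)" "g \<in> Poly_Mapping.keys (eval_monomial F m $ N)"
        using less.prems by (auto simp: rhs keys_eval_rhs)
      have small: "monomial_degree m \<le> K"
        using K less.prems m by blast
      show ?thesis
      proof (cases m)
        case (Const r k)
        then show ?thesis
          using m small False by (auto simp: keys_eval_Const simp del: eval_monomial.simps split: if_splits)
      next
        case (Linear r j k)
        have "proper_monomial n m"
          using P less.prems m unfolding proper_linear_system_def by blast
        then have jk: "j \<in> {1..n}" "k \<ge> 1"
          by (auto simp: Linear)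
        obtain a c where ac: "g = a + c" "a \<in> Poly_Mapping.keys r"
            "c \<in> Poly_Mapping.keys (F j $ (N - k))" "k \<le> N"
          using m(2) unfolding Linear keys_eval_Linear by (auto split: if_splits)
        have "N - k < N" "N - k > M"
          using False small jk ac Linear by auto
        then obtain h N' where h: "h \<in> H" "N' > N - k" "c + h \<in> Poly_Mapping.keys (F j $ N')"
          using less.IH jk ac by meson
        have "a + (c + h) \<in> Poly_Mapping.keys (eval_monomial F m $ (N' + k))"
          using ac h unfolding Linear keys_eval_Linear by auto
        then have "g + h \<in> Poly_Mapping.keys (F i $ (N' + k))"
          using m(1) unfolding rhs keys_eval_rhs ac(1) add.assoc by blast
        then show ?thesis
          using h by (intro bexI[of _ h] exI[of _ "N' + k"]) auto
      qed
    qed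
  qed
  ultimately show ?thesis
    by (intro exI[of _ H] exI[of _ M] conjI ballI allI impI)
qed

section \<open>Balls and dead ends\<close>

lemma finite_word_length_ball:
  fixes S :: "'a::group_add set"
  assumes "finite S" "symmetric_set S" "generates S"
  shows "finite {g. word_length S g \<le> M}"
proof (rule finite_subset)
  show "{g. word_length S g \<le> M} \<subseteq> sum_list ` {w. set w \<subseteq> S \<and> length w \<le> M}"
  proof clarify
    fix g assume "word_length S g \<le> M"
    have "S \<union> uminus ` S = S"
      using assms(2) by (auto simp: symmetric_set_def)
    then have "\<exists>l w. length w = l \<and> set w \<subseteq> S \<and> sum_list w = g"
      using assms(3) by (auto simp: generates_def)
    then have "\<exists>w. length w = word_length S g \<and> set w \<subseteq> S \<and> sum_list w = g"
      unfolding word_length_def by (rule LeastI_ex)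
    then show "g \<in> sum_list ` {w. set w \<subseteq> S \<and> length w \<le> M}"
      using \<open>word_length S g \<le> M\<close> by auto
  qed
  show "finite (sum_list ` {w. set w \<subseteq> S \<and> length w \<le> M})"
    using finite_lists_length_le[OF assms(1)] by simp
qed

lemma keys_complete_growth_series:
  fixes S :: "'a::group_add set"
  assumes "finite S" "symmetric_set S" "generates S"
  shows "Poly_Mapping.keys (complete_growth_series S $ N) = {g. word_length S g = N}"
proof -
  have fin: "finite {g. word_length S g = N}"
    by (rule finite_subset[OF _ finite_word_length_ball[OF assms, of N]]) auto
  have "Poly_Mapping.lookup (complete_growth_series S $ N) g = (if word_length S g = N then 1 else 0)" for g
    using fin by (simp add: complete_growth_series_def lookup_sum lookup_single when_def)
  then show ?thesis
    by (auto simp: in_keys_iff split: if_splits)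
qed

text \<open>
  Fix \<open>x\<close> of length greater than \<open>M\<close>. If \<open>g\<close> has length at most \<open>M\<close>, then right multiplication by
  \<open>- g + x\<close>, which takes only finitely many values, increases the length of \<open>g\<close>.
\<close>

lemma dead_end_long:
  fixes S :: "'a::group_add set"
  assumes "infinite (UNIV :: 'a set)" "finite S" "symmetric_set S" "generates S"
  shows "\<exists>D0. \<forall>D\<ge>D0. \<forall>g. dead_end S D g \<longrightarrow> word_length S g > M"
proof -
  let ?B = "{g. word_length S g \<le> M}"
  have fin: "finite ?B"
    using assms by (intro finite_word_length_ball)
  then obtain x where x: "x \<notin> ?B"
    using assms(1) ex_new_if_finite by blast
  define D0 where "D0 = (\<Sum>g\<in>?B. word_length S (- g + x))"
  have "word_length S g > M" if "D \<ge> D0" "dead_end S D g" for D g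
  proof (rule ccontr)
    assume "\<not> word_length S g > M"
    then have g: "g \<in> ?B"
      by simp
    have "word_length S (- g + x) \<le> D0"
      unfolding D0_def by (rule member_le_sum[OF g _ fin]) simp
    then have "word_length S (g + (- g + x)) \<le> word_length S g"
      using that unfolding dead_end_def by (meson le_trans)
    then show False
      using x g by (simp add: add.assoc[symmetric])
  qed
  then show ?thesis
    by blast
qed

section \<open>Non-rationality of the complete growth series\<close>

theorem theorem1:
  fixes S :: "'a::group_add set"
  assumes "infinite (UNIV :: 'a set)"
    and "finite S" and "symmetric_set S" and "generates S"
    and "\<And>D. D > 0 \<Longrightarrow> \<exists>g. dead_end S D g"
  shows "\<not> rational_series (complete_growth_series S)"
proof
  assume "rational_series (complete_growth_series S)"
  then obtain n P X where n: "n \<ge> 1" and sys: "proper_linear_system n P" "proper_solution n P X"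
    and X: "X 1 = Abs_fps (\<lambda>k. if k = 0 then 0 else complete_growth_series S $ k)"
    unfolding rational_series_def by blast
  have X1: "g \<in> Poly_Mapping.keys (X 1 $ N) \<longleftrightarrow> N > 0 \<and> word_length S g = N" for g N
    unfolding X using keys_complete_growth_series[OF assms(2-4), of N] by auto
  obtain H M where H: "finite H"
    and ext: "\<forall>i\<in>{1..n}. \<forall>N>M. \<forall>g\<in>Poly_Mapping.keys (X i $ N).
           \<exists>h\<in>H. \<exists>N'>N. g + h \<in> Poly_Mapping.keys (X i $ N')"
    using proper_solution_bounded_extension[OF sys] by (elim exE conjE)
  obtain D0 where D0: "\<forall>D\<ge>D0. \<forall>g. dead_end S D g \<longrightarrow> word_length S g > M"
    using dead_end_long[OF assms(1-4), of M] by (elim exE)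
  define D where "D = D0 + (\<Sum>h\<in>H. word_length S h) + 1"
  obtain g where g: "dead_end S D g"
    using assms(5)[of D] by (auto simp: D_def)
  have "D0 \<le> D"
    by (simp add: D_def)
  then have long: "word_length S g > M"
    using D0 g by blast
  then have "g \<in> Poly_Mapping.keys (X 1 $ word_length S g)"
    unfolding X1 by simp
  then obtain h N' where h: "h \<in> H" "N' > word_length S g" "g + h \<in> Poly_Mapping.keys (X 1 $ N')"
    using ext n long by (meson atLeastAtMost_iff order_refl)
  have "word_length S h \<le> (\<Sum>h\<in>H. word_length S h)"
    using h H by (intro member_le_sum) auto
  then have "word_length S (g + h) \<le> word_length S g"
    using g unfolding dead_end_def D_def by simp
  then show False
    using h unfolding X1 by simp
qed

end
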